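(* Let $n\ge2$, $P,Q\in\Gamma_n$ and $s\in\mathbb{R}$. Let $r,R$ be real numbers with $0<r\le1\le R<\infty$ and $r\le p_i/q_i\le R$ for all $i\in\{1,\dots,n\}$; in the inequalities involving $\beta_{\Phi_s}(r,R)$ assume $r<R$. (a) If $s\le-1$, then $$\frac{8r^{2-s}}{(r+1)^3}\Phi_s(P\|Q)\le\Delta(P\|Q)\le\frac{8R^{2-s}}{(R+1)^3}\Phi_s(P\|Q),$$ $$\frac{8r^{2-s}}{(r+1)^3}\left[\rho_{\Phi_s}(P\|Q)-\Phi_s(P\|Q)\right]\le\Delta^*(P\|Q)\le\frac{8R^{2-s}}{(R+1)^3}\left[\rho_{\Phi_s}(P\|Q)-\Phi_s(P\|Q)\right]$$ and $$\frac{8r^{2-s}}{(r+1)^3}\left[\beta_{\Phi_s}(r,R)-\Phi_s(P\|Q)\right]\le\beta_\Delta(r,R)-\Delta(P\|Q)\le\frac{8R^{2-s}}{(R+1)^3}\left[\beta_{\Phi_s}(r,R)-\Phi_s(P\|Q)\right].$$ (b) If $s\ge2$, then $$\frac{8R^{2-s}}{(R+1)^3}\Phi_s(P\|Q)\le\Delta(P\|Q)\le\frac{8r^{2-s}}{(r+1)^3}\Phi_s(P\|Q),$$ $$\frac{8R^{2-s}}{(R+1)^3}\left[\rho_{\Phi_s}(P\|Q)-\Phi_s(P\|Q)\right]\le\Delta^*(P\|Q)\le\frac{8r^{2-s}}{(r+1)^3}\left[\rho_{\Phi_s}(P\|Q)-\Phi_s(P\|Q)\right]$$ and $$\frac{8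R^{2-s}}{(R+1)^3}\left[\beta_{\Phi_s}(r,R)-\Phi_s(P\|Q)\right]\le\beta_\Delta(r,R)-\Delta(P\|Q)\le\frac{8r^{2-s}}{(r+1)^3}\left[\beta_{\Phi_s}(r,R)-\Phi_s(P\|Q)\right].$$
   Context: $\Gamma_n=\{P=(p_1,\dots,p_n): p_i>0,\ \sum_{i=1}^n p_i=1\}$, $n\ge2$. For $P,Q\in\Gamma_n$: Triangular discrimination: $\Delta(P\|Q)=\sum_{i=1}^n\frac{(p_i-q_i)^2}{p_i+q_i}$; also $\Delta^*(P\|Q)=2\sum_{i=1}^n q_i\left(\frac{p_i-q_i}{p_i+q_i}\right)^2$ and $\beta_\Delta(r,R)=\frac{2(R-1)(1-r)}{(R+1)(1+r)}$. Relative information of type $s$: $\Phi_s(P\|Q)=[s(s-1)]^{-1}\left[\sum_{i=1}^n p_i^sq_i^{1-s}-1\right]$ for $s\neq0,1$; $\Phi_0(P\|Q)=\sum_{i=1}^n q_i\ln\frac{q_i}{p_i}$; $\Phi_1(P\|Q)=\sum_{i=1}^n p_i\ln\frac{p_i}{q_i}$. $\rho_{\Phi_s}(P\|Q)=(s-1)^{-1}\sum_{i=1}^n(p_i-q_i)\left(\frac{p_i}{q_i}\right)^{s-1}$ for $s\ne1$, and $\rho_{\Phi_1}(P\|Q)=\sum_{i=1}^n(p_i-q_i)\ln\frac{p_i}{q_i}$. $\beta_{\Phi_s}(r,R)=\frac{(R-1)(r^s-1)+(1-r)(R^s-1)}{(R-r)s(s-1)}$ for $s\neq0,1$ (only $s\le-1$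 or $s\ge2$ is used here). *)

theory Defs
  imports "HOL-Analysis.Analysis"
begin

text \<open>
  A vector \<open>(p\<^sub>1, \<dots>, p\<^sub>n)\<close> is an element of \<^typ>\<open>real ^ 'n\<close> with \<open>n = CARD('n)\<close>. Real powers are
  written with \<^const>\<open>powr\<close>, which is the usual power here since all bases are positive.
\<close>

definition Gamma_set :: "(real ^ 'n::finite) set" where
  "Gamma_set = {P. (\<forall>i. P $ i > 0) \<and> (\<Sum>i\<in>UNIV. P $ i) = 1}"

definition triang_discr :: "real ^ 'n::finite \<Rightarrow> real ^ 'n \<Rightarrow> real" where
  "triang_discr P Q = (\<Sum>i\<in>UNIV. (P $ i - Q $ i)\<^sup>2 / (P $ i + Q $ i))"

definition triang_discr_star :: "real ^ 'n::finite \<Rightarrow> real ^ 'n \<Rightarrow> real" where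
  "triang_discr_star P Q =
     2 * (\<Sum>i\<in>UNIV. Q $ i * ((P $ i - Q $ i) / (P $ i + Q $ i))\<^sup>2)"

definition beta_triang :: "real \<Rightarrow> real \<Rightarrow> real" where
  "beta_triang r R = 2 * (R - 1) * (1 - r) / ((R + 1) * (1 + r))"

definition rel_info :: "real \<Rightarrow> real ^ 'n::finite \<Rightarrow> real ^ 'n \<Rightarrow> real" where
  "rel_info s P Q =
     (if s = 0 then \<Sum>i\<in>UNIV. Q $ i * ln (Q $ i / P $ i)
      else if s = 1 then \<Sum>i\<in>UNIV. P $ i * ln (P $ i / Q $ i)
      else inverse (s * (s - 1)) * ((\<Sum>i\<in>UNIV. P $ i powr s * Q $ i powr (1 - s)) - 1))"

definition rho_rel_info :: "real \<Rightarrow> real ^ 'n::finite \<Rightarrow> real ^ 'n \<Rightarrow> real" where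
  "rho_rel_info s P Q =
     (if s = 1 then \<Sum>i\<in>UNIV. (P $ i - Q $ i) * ln (P $ i / Q $ i)
      else inverse (s - 1) * (\<Sum>i\<in>UNIV. (P $ i - Q $ i) * (P $ i / Q $ i) powr (s - 1)))"

text \<open>
  Meaningful only for \<open>r \<noteq> R\<close> and \<open>s \<notin> {0, 1}\<close>; otherwise the denominator vanishes and
  the value is \<open>0\<close> by the convention for division by zero.
\<close>

definition beta_rel_info :: "real \<Rightarrow> real \<Rightarrow> real \<Rightarrow> real" where
  "beta_rel_info s r R =
     ((R - 1) * (r powr s - 1) + (1 - r) * (R powr s - 1)) / ((R - r) * s * (s - 1))"

end

theory Submission
  imports Defs
begin

text \<open>
  Both divergences are Csiszar divergences \<open>\<Sum> q\<^sub>i f (p\<^sub>i / q\<^sub>i)\<close>: \<open>f t = (t - 1)\<^sup>2 / (t + 1)\<close> gives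
  \<open>\<Delta>\<close> and \<open>f t = (t powr s - 1) / (s (s - 1))\<close> gives \<open>\<Phi>\<^sub>s\<close>; the second derivatives are
  \<open>8 / (t + 1)\<^sup>3\<close> and \<open>t powr (s - 2)\<close>. Their quotient \<open>8 t powr (2 - s) / (t + 1)\<^sup>3\<close> is monotone
  for \<open>s \<le> -1\<close> and antitone for \<open>s \<ge> 2\<close>, so its values at \<open>r\<close> and \<open>R\<close> bound it, and certain linear
  combinations \<open>h\<close> of the two generators are convex on \<open>{r..R}\<close>. The three families of
  inequalities are convexity of \<open>h\<close> in three forms, summed over \<open>i\<close>: the tangent at \<open>1\<close> lies below
  \<open>h\<close>, the tangent at \<open>p\<^sub>i / q\<^sub>i\<close> lies below \<open>h\<close> at \<open>1\<close>, and the chord over \<open>{r..R}\<close> lies above \<open>h\<close>.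
\<close>

section \<open>Csiszar divergences and the inequalities that convexity gives for them\<close>

definition csiszar :: "(real \<Rightarrow> real) \<Rightarrow> real ^ 'n::finite \<Rightarrow> real ^ 'n \<Rightarrow> real" where
  "csiszar f P Q = (\<Sum>i\<in>UNIV. Q $ i * f (P $ i / Q $ i))"

definition rho_csiszar :: "(real \<Rightarrow> real) \<Rightarrow> real ^ 'n::finite \<Rightarrow> real ^ 'n \<Rightarrow> real" where
  "rho_csiszar f' P Q = (\<Sum>i\<in>UNIV. (P $ i - Q $ i) * f' (P $ i / Q $ i))"

text \<open>The value at \<open>1\<close> of the chord of \<open>f\<close> over
  \<open>{r..R}\<close>.\<close>

definition beta_csiszar :: "(real \<Rightarrow> real) \<Rightarrow> real \<Rightarrow> real \<Rightarrow> real" where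
  "beta_csiszar f r R = ((R - 1) * f r + (1 - r) * f R) / (R - r)"

lemma csiszar_combination:
  "csiszar (\<lambda>t. a * f t + b * g t) P Q = a * csiszar f P Q + b * csiszar g P Q"
  by (simp add: csiszar_def sum_distrib_left sum.distrib algebra_simps)

lemma rho_csiszar_combination:
  "rho_csiszar (\<lambda>t. a * f t + b * g t) P Q = a * rho_csiszar f P Q + b * rho_csiszar g P Q"
  by (simp add: rho_csiszar_def sum_distrib_left sum.distrib distrib_left mult.left_commute)

lemma beta_csiszar_combination:
  "beta_csiszar (\<lambda>t. a * f t + b * g t) r R = a * beta_csiszar f r R + b * beta_csiszar g r R"
proof -
  have "(R - 1) * (a * f r + b * g r) + (1 - r) * (a * f R + b * g R) =
      a * ((R - 1) * f r + (1 - r) * f R) + b * ((R - 1) * g r + (1 - r) * g R)"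
    by (simp add: algebra_simps)
  then show ?thesis
    by (simp only: beta_csiszar_def add_divide_distrib[symmetric] times_divide_eq_right)
qed

text \<open>The weights \<open>Q $ i\<close> sum to \<open>1\<close> and the ratios
  \<open>P $ i / Q $ i\<close> have mean \<open>1\<close> under them, so an affine function averages
  to its value at \<open>1\<close>. Tangents and chords are evaluated this way.\<close>

lemma csiszar_affine:
  fixes P Q :: "real ^ 'n::finite"
  assumes "P \<in> Gamma_set" "Q \<in> Gamma_set"
  shows "csiszar (\<lambda>t. a + b * t) P Q = a + b"
proof -
  have "Q $ i * (a + b * (P $ i / Q $ i)) = a * Q $ i + b * P $ i" for i
  proof -
    have "Q $ i > 0" using assms by (auto simp: Gamma_set_def)
    then show ?thesis by (simp add: field_simps)
  qed
  then have "csiszar (\<lambda>t. a + b * t) P Q = (\<Sum>i\<in>UNIV. a * Q $ i + b * P $ i)"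
    by (simp add: csiszar_def)
  also have "\<dots> = a * (\<Sum>i\<in>UNIV. Q $ i) + b * (\<Sum>i\<in>UNIV. P $ i)"
    by (simp add: sum.distrib sum_distrib_left)
  also have "\<dots> = a + b"
    using assms by (simp add: Gamma_set_def)
  finally show ?thesis .
qed

lemma csiszar_mono:
  fixes P Q :: "real ^ 'n::finite"
  assumes "Q \<in> Gamma_set" "\<And>i. f (P $ i / Q $ i) \<le> g (P $ i / Q $ i)"
  shows "csiszar f P Q \<le> csiszar g P Q"
  using assms unfolding csiszar_def
  by (intro sum_mono mult_left_mono) (auto simp: Gamma_set_def less_imp_le)

text \<open>Puts the sum into a form where pointwise bounds apply through
  \<open>csiszar_mono\<close>.\<close>

lemma rho_csiszar_eq_csiszar:
  fixes P Q :: "real ^ 'n::finite"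
  assumes "Q \<in> Gamma_set"
  shows "rho_csiszar f' P Q = csiszar (\<lambda>t. (t - 1) * f' t) P Q"
  unfolding rho_csiszar_def csiszar_def
proof (intro sum.cong refl)
  fix i
  have "Q $ i > 0" using assms by (auto simp: Gamma_set_def)
  then show "(P $ i - Q $ i) * f' (P $ i / Q $ i) =
      Q $ i * ((P $ i / Q $ i - 1) * f' (P $ i / Q $ i))"
    by (simp add: field_simps)
qed

lemma csiszar_convex:
  fixes P Q :: "real ^ 'n::finite"
  assumes P: "P \<in> Gamma_set" and Q: "Q \<in> Gamma_set"
    and r: "r \<le> 1" and R: "1 \<le> R"
    and bounds: "\<And>i. P $ i / Q $ i \<in> {r..R}"
    and f': "\<And>t. t \<in> {r..R} \<Longrightarrow> (f has_real_derivative f' t) (at t)"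
    and f'': "\<And>t. t \<in> {r..R} \<Longrightarrow> (f' has_real_derivative f'' t) (at t)"
    and nonneg: "\<And>t. t \<in> {r..R} \<Longrightarrow> 0 \<le> f'' t"
    and f1: "f 1 = 0"
  shows "0 \<le> csiszar f P Q"
    and "csiszar f P Q \<le> rho_csiszar f' P Q"
    and "r < R \<Longrightarrow> csiszar f P Q \<le> beta_csiszar f r R"
proof -
  have tangent: "f' x * (y - x) \<le> f y - f x" if "x \<in> {r..R}" "y \<in> {r..R}" for x y
    using f''_imp_f'[of "{r..R}", OF _ f' f'' nonneg that] by simp
  have one: "1 \<in> {r..R}" using r R by simp
  \<comment> \<open>The tangent at \<open>1\<close> is \<open>f' 1 * (t - 1)\<close>, as
    \<open>f 1 = 0\<close>; its coefficients add up to \<open>0\<close>.\<close>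
  have "csiszar (\<lambda>t. - f' 1 + f' 1 * t) P Q \<le> csiszar f P Q"
    using tangent[OF one bounds] f1
    by (intro csiszar_mono[OF Q]) (auto simp: algebra_simps)
  then show "0 \<le> csiszar f P Q"
    by (simp only: csiszar_affine[OF P Q])
  show "csiszar f P Q \<le> rho_csiszar f' P Q"
    \<comment> \<open>The tangent at \<open>t\<close>, evaluated at \<open>1\<close> where
      \<open>f\<close> vanishes, gives \<open>f t \<le> (t - 1) * f' t\<close>.\<close>
    unfolding rho_csiszar_eq_csiszar[OF Q] using tangent[OF bounds one] f1
    by (intro csiszar_mono[OF Q]) (auto simp: algebra_simps)
  assume "r < R"
  have convex: "convex_on {r..R} f"
    using f''_ge0_imp_convex[of "{r..R}", OF _ f' f'' nonneg] by simp
  define k where "k = (f R - f r) / (R - r)"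
  have chord: "f t \<le> (f r - k * r) + k * t" if "t \<in> {r..R}" for t
    using convex_onD_Icc'[OF convex that, folded k_def] by (simp add: algebra_simps)
  have "csiszar f P Q \<le> csiszar (\<lambda>t. (f r - k * r) + k * t) P Q"
    by (intro csiszar_mono[OF Q] chord bounds)
  also have "\<dots> = f r + k * (1 - r)"
    unfolding csiszar_affine[OF P Q] by (simp add: algebra_simps)
  also have "\<dots> = beta_csiszar f r R"
    using \<open>r < R\<close> by (simp add: beta_csiszar_def k_def field_simps)
  finally show "csiszar f P Q \<le> beta_csiszar f r R" .
qed

section \<open>The generators of the two divergences and their derivatives\<close>

definition triang_gen :: "real \<Rightarrow> real" where
  "triang_gen t = (t - 1)\<^sup>2 / (t + 1)"

definition triang_gen' :: "real \<Rightarrow> real" where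
  "triang_gen' t = (t - 1) * (t + 3) / (t + 1)\<^sup>2"

text \<open>The constant \<open>- 1\<close> makes the value at \<open>1\<close> zero. Adding a
  multiple of \<open>t - 1\<close> would leave the divergence of distributions unchanged, so no
  linear term is included.\<close>

definition rel_gen :: "real \<Rightarrow> real \<Rightarrow> real" where
  "rel_gen s t = (t powr s - 1) / (s * (s - 1))"

definition rel_gen' :: "real \<Rightarrow> real \<Rightarrow> real" where
  "rel_gen' s t = t powr (s - 1) / (s - 1)"

lemma has_real_derivative_triang_gen:
  assumes "t > 0"
  shows "(triang_gen has_real_derivative triang_gen' t) (at t)"
  unfolding triang_gen_def triang_gen'_def using assms
  by (auto intro!: derivative_eq_intros simp: divide_simps power2_eq_square) (simp add: algebra_simps)

lemma has_real_derivative_triang_gen':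
  assumes "t > 0"
  shows "(triang_gen' has_real_derivative 8 / (t + 1) ^ 3) (at t)"
  unfolding triang_gen'_def using assms
  by (auto intro!: derivative_eq_intros simp: divide_simps)
    (simp add: algebra_simps eval_nat_numeral)

lemma has_real_derivative_rel_gen:
  assumes "t > 0" "s \<noteq> 0"
  shows "(rel_gen s has_real_derivative rel_gen' s t) (at t)"
  unfolding rel_gen_def rel_gen'_def using assms
  by (cases "s = 1") (auto intro!: derivative_eq_intros)

lemma has_real_derivative_rel_gen':
  assumes "t > 0" "s \<noteq> 1"
  shows "(rel_gen' s has_real_derivative t powr (s - 2)) (at t)"
  unfolding rel_gen'_def using assms
  by (auto intro!: derivative_eq_intros)

lemma triang_discr_eq_csiszar:
  fixes P Q :: "real ^ 'n::finite"
  assumes "P \<in> Gamma_set" "Q \<in> Gamma_set"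
  shows "triang_discr P Q = csiszar triang_gen P Q"
  unfolding triang_discr_def csiszar_def triang_gen_def
proof (intro sum.cong refl)
  fix i
  have "P $ i > 0" "Q $ i > 0" using assms by (auto simp: Gamma_set_def)
  then show "(P $ i - Q $ i)\<^sup>2 / (P $ i + Q $ i) =
      Q $ i * ((P $ i / Q $ i - 1)\<^sup>2 / (P $ i / Q $ i + 1))"
    by (simp add: divide_simps power2_eq_square)
qed

text \<open>For \<open>f = triang_gen\<close> one has
  \<open>(t - 1) * f' t - f t = 2 * ((t - 1) / (t + 1))\<^sup>2\<close>. So
  \<open>triang_discr_star\<close> is to \<open>triang_discr\<close> what
  \<open>rho_rel_info - rel_info\<close> is to \<open>rel_info\<close>.\<close>

lemma triang_discr_star_eq:
  fixes P Q :: "real ^ 'n::finite"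
  assumes "P \<in> Gamma_set" "Q \<in> Gamma_set"
  shows "triang_discr_star P Q = rho_csiszar triang_gen' P Q - triang_discr P Q"
  unfolding triang_discr_star_def triang_discr_def rho_csiszar_def triang_gen'_def
    sum_subtractf[symmetric] sum_distrib_left
proof (intro sum.cong refl)
  fix i
  define p q where "p = P $ i" and "q = Q $ i"
  have pos: "p > 0" "q > 0" using assms by (auto simp: Gamma_set_def p_def q_def)
  have "(p / q - 1) * (p / q + 3) / (p / q + 1)\<^sup>2 = (p - q) * (p + 3 * q) / (p + q)\<^sup>2"
    using pos by (simp add: divide_simps power2_eq_square)
  moreover have "2 * (q * ((p - q) / (p + q))\<^sup>2) =
      (p - q) * ((p - q) * (p + 3 * q) / (p + q)\<^sup>2) - (p - q)\<^sup>2 / (p + q)"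
    using pos by (simp add: divide_simps power2_eq_square) (simp add: algebra_simps)
  ultimately show "2 * (Q $ i * ((P $ i - Q $ i) / (P $ i + Q $ i))\<^sup>2) =
      (P $ i - Q $ i) * ((P $ i / Q $ i - 1) * (P $ i / Q $ i + 3) / (P $ i / Q $ i + 1)\<^sup>2) -
      (P $ i - Q $ i)\<^sup>2 / (P $ i + Q $ i)"
    by (simp add: p_def q_def)
qed

text \<open>The chord's numerator factors as \<open>2 * (R - 1) * (1 - r) * (R - r)\<close> over
  \<open>(R + 1) * (1 + r)\<close>, and \<open>R - r\<close> cancels.\<close>

lemma beta_triang_eq_beta_csiszar:
  assumes "0 < r" "r < R"
  shows "beta_triang r R = beta_csiszar triang_gen r R"
  unfolding beta_triang_def beta_csiszar_def triang_gen_def using assms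
  by (simp add: divide_simps power2_eq_square) (simp add: algebra_simps)

lemma rel_info_eq_csiszar:
  fixes P Q :: "real ^ 'n::finite"
  assumes "P \<in> Gamma_set" "Q \<in> Gamma_set" "s \<noteq> 0" "s \<noteq> 1"
  shows "rel_info s P Q = csiszar (rel_gen s) P Q"
proof -
  have "P $ i powr s * Q $ i powr (1 - s) = Q $ i * (P $ i / Q $ i) powr s" for i
  proof -
    have "P $ i > 0" "Q $ i > 0" using assms by (auto simp: Gamma_set_def)
    then show ?thesis by (simp add: powr_divide powr_diff)
  qed
  moreover have "(\<Sum>i\<in>UNIV. Q $ i) = 1"
    using assms by (simp add: Gamma_set_def)
  ultimately show ?thesis
    using assms unfolding rel_info_def csiszar_def rel_gen_def
    by (simp add: right_diff_distrib sum_subtractf diff_divide_distrib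
        sum_divide_distrib[symmetric] inverse_eq_divide)
qed

lemma rho_rel_info_eq_rho_csiszar:
  "s \<noteq> 1 \<Longrightarrow> rho_rel_info s P Q = rho_csiszar (rel_gen' s) P Q"
  by (simp add: rho_rel_info_def rho_csiszar_def rel_gen'_def sum_divide_distrib inverse_eq_divide)

lemma beta_rel_info_eq_beta_csiszar:
  "beta_rel_info s r R = beta_csiszar (rel_gen s) r R"
  unfolding beta_rel_info_def beta_csiszar_def rel_gen_def
  by (simp add: add_divide_distrib mult_ac)

text \<open>The signs of \<open>a\<close> and \<open>b\<close> are left free so that lower and upper
  bounds are both instances.\<close>

lemma triang_discr_rel_info_combination:
  fixes P Q :: "real ^ 'n::finite"
  assumes P: "P \<in> Gamma_set" and Q: "Q \<in> Gamma_set"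
    and r: "0 < r" "r \<le> 1" and R: "1 \<le> R"
    and bounds: "\<And>i. P $ i / Q $ i \<in> {r..R}"
    and s: "s \<noteq> 0" "s \<noteq> 1"
    and nonneg: "\<And>t. t \<in> {r..R} \<Longrightarrow> 0 \<le> a * (8 / (t + 1) ^ 3) + b * t powr (s - 2)"
  shows "0 \<le> a * triang_discr P Q + b * rel_info s P Q"
    and "0 \<le> a * triang_discr_star P Q + b * (rho_rel_info s P Q - rel_info s P Q)"
    and "r < R \<Longrightarrow> 0 \<le> a * (beta_triang r R - triang_discr P Q) +
      b * (beta_rel_info s r R - rel_info s P Q)"
proof -
  let ?h = "\<lambda>t. a * triang_gen t + b * rel_gen s t"
  let ?h' = "\<lambda>t. a * triang_gen' t + b * rel_gen' s t"
  have h': "(?h has_real_derivative ?h' t) (at t)" if "t \<in> {r..R}" for t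
    using that r s
    by (intro DERIV_add DERIV_cmult has_real_derivative_triang_gen has_real_derivative_rel_gen) auto
  have h'': "(?h' has_real_derivative a * (8 / (t + 1) ^ 3) + b * t powr (s - 2)) (at t)"
    if "t \<in> {r..R}" for t
    using that r s
    by (intro DERIV_add DERIV_cmult has_real_derivative_triang_gen' has_real_derivative_rel_gen') auto
  have h1: "?h 1 = 0"
    by (simp add: triang_gen_def rel_gen_def)
  note convex = csiszar_convex[OF P Q r(2) R bounds h' h'' nonneg h1]
  note eqs = triang_discr_star_eq[OF P Q] triang_discr_eq_csiszar[OF P Q]
    rel_info_eq_csiszar[OF P Q s] rho_rel_info_eq_rho_csiszar[OF s(2)]
    beta_rel_info_eq_beta_csiszar
  note combs = csiszar_combination rho_csiszar_combination beta_csiszar_combination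
  show "0 \<le> a * triang_discr P Q + b * rel_info s P Q"
    using convex(1) unfolding eqs combs .
  show "0 \<le> a * triang_discr_star P Q + b * (rho_rel_info s P Q - rel_info s P Q)"
    using convex(2) unfolding eqs combs by (simp add: algebra_simps)
  assume "r < R"
  with convex(3)
  show "0 \<le> a * (beta_triang r R - triang_discr P Q) + b * (beta_rel_info s r R - rel_info s P Q)"
    unfolding eqs beta_triang_eq_beta_csiszar[OF r(1) \<open>r < R\<close>] combs by (simp add: algebra_simps)
qed

section \<open>Monotonicity of the quotient of second derivatives, and the resulting bounds\<close>

definition curv_ratio :: "real \<Rightarrow> real \<Rightarrow> real" where
  "curv_ratio s t = 8 * t powr (2 - s) / (t + 1) ^ 3"

lemma curv_ratio_mult:
  assumes "t > 0"
  shows "curv_ratio s t * t powr (s - 2) = 8 / (t + 1) ^ 3"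
proof -
  have "t powr (2 - s) * t powr (s - 2) = 1"
    using assms by (simp flip: powr_add)
  then show ?thesis by (simp add: curv_ratio_def)
qed

text \<open>Splitting \<open>2 - s\<close> as \<open>(-1 - s) + 3\<close> leaves a power with
  nonnegative exponent, by \<open>s \<le> -1\<close>, times the cube of the increasing function
  \<open>t / (t + 1)\<close>.\<close>

lemma curv_ratio_mono:
  assumes "s \<le> -1" "0 < t" "t \<le> u"
  shows "curv_ratio s t \<le> curv_ratio s u"
proof -
  have eq: "curv_ratio s x = 8 * (x powr (-1 - s) * (x / (x + 1)) ^ 3)" if "x > 0" for x
  proof -
    have "x powr (2 - s) = x powr (-1 - s) * x ^ 3"
      using that powr_add[of x "-1 - s" 3] by simp
    then show ?thesis by (simp add: curv_ratio_def power_divide)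
  qed
  have "t / (t + 1) \<le> u / (u + 1)"
    using assms by (simp add: field_simps)
  then have "t powr (-1 - s) * (t / (t + 1)) ^ 3 \<le> u powr (-1 - s) * (u / (u + 1)) ^ 3"
    using assms by (intro mult_mono power_mono powr_mono2) auto
  then show ?thesis using assms by (simp add: eq)
qed

text \<open>The exponent \<open>2 - s\<close> is nonpositive, so the numerator decreases while the
  denominator grows.\<close>

lemma curv_ratio_antimono:
  assumes "s \<ge> 2" "0 < t" "t \<le> u"
  shows "curv_ratio s u \<le> curv_ratio s t"
  unfolding curv_ratio_def using assms
  by (intro frac_le mult_left_mono powr_mono2' power_mono) auto

lemma triang_discr_rel_info_bounds:
  fixes P Q :: "real ^ 'n::finite"
  assumes P: "P \<in> Gamma_set" and Q: "Q \<in> Gamma_set"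
    and r: "0 < r" "r \<le> 1" and R: "1 \<le> R"
    and bounds: "\<And>i. P $ i / Q $ i \<in> {r..R}"
    and s: "s \<noteq> 0" "s \<noteq> 1"
    and m: "\<And>t. t \<in> {r..R} \<Longrightarrow> m \<le> curv_ratio s t"
    and M: "\<And>t. t \<in> {r..R} \<Longrightarrow> curv_ratio s t \<le> M"
  shows "m * rel_info s P Q \<le> triang_discr P Q \<and>
    triang_discr P Q \<le> M * rel_info s P Q \<and>
    m * (rho_rel_info s P Q - rel_info s P Q) \<le> triang_discr_star P Q \<and>
    triang_discr_star P Q \<le> M * (rho_rel_info s P Q - rel_info s P Q) \<and>
    (r < R \<longrightarrow>
      m * (beta_rel_info s r R - rel_info s P Q) \<le> beta_triang r R - triang_discr P Q \<and>
      beta_triang r R - triang_discr P Q \<le> M * (beta_rel_info s r R - rel_info s P Q))"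
proof -
  \<comment> \<open>By \<open>curv_ratio_mult\<close> this second derivative is
    \<open>(curv_ratio s t - m) * t powr (s - 2)\<close>; the upper bound uses
    \<open>M - curv_ratio s t\<close> instead.\<close>
  have lower: "0 \<le> 1 * (8 / (t + 1) ^ 3) + (- m) * t powr (s - 2)" if "t \<in> {r..R}" for t
    using mult_right_mono[OF m[OF that], of "t powr (s - 2)"] curv_ratio_mult[of t s] that r
    by simp
  have upper: "0 \<le> (- 1) * (8 / (t + 1) ^ 3) + M * t powr (s - 2)" if "t \<in> {r..R}" for t
    using mult_right_mono[OF M[OF that], of "t powr (s - 2)"] curv_ratio_mult[of t s] that r
    by simp
  note L = triang_discr_rel_info_combination[OF P Q r R bounds s lower]
  note U = triang_discr_rel_info_combination[OF P Q r R bounds s upper]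
  show ?thesis
    using L U by (auto simp: algebra_simps)
qed

theorem theorem4p2:
  fixes P Q :: "real ^ 'n::finite" and s r R :: real
  assumes "CARD('n) \<ge> 2"
    and "P \<in> Gamma_set" and "Q \<in> Gamma_set"
    and "0 < r" and "r \<le> 1" and "1 \<le> R"
    and "\<And>i. r \<le> P $ i / Q $ i" and "\<And>i. P $ i / Q $ i \<le> R"
  shows "(s \<le> -1 \<longrightarrow>
        8 * r powr (2 - s) / (r + 1) ^ 3 * rel_info s P Q \<le> triang_discr P Q \<and>
        triang_discr P Q \<le> 8 * R powr (2 - s) / (R + 1) ^ 3 * rel_info s P Q \<and>
        8 * r powr (2 - s) / (r + 1) ^ 3 * (rho_rel_info s P Q - rel_info s P Q) \<le> triang_discr_star P Q \<and>
        triang_discr_star P Q \<le> 8 * R powr (2 - s) / (R + 1) ^ 3 * (rho_rel_info s P Q - rel_info s P Q) \<and>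
        (r < R \<longrightarrow>
        8 * r powr (2 - s) / (r + 1) ^ 3 * (beta_rel_info s r R - rel_info s P Q) \<le> beta_triang r R - triang_discr P Q \<and>
        beta_triang r R - triang_discr P Q \<le> 8 * R powr (2 - s) / (R + 1) ^ 3 * (beta_rel_info s r R - rel_info s P Q))) \<and>
      (s \<ge> 2 \<longrightarrow>
        8 * R powr (2 - s) / (R + 1) ^ 3 * rel_info s P Q \<le> triang_discr P Q \<and>
        triang_discr P Q \<le> 8 * r powr (2 - s) / (r + 1) ^ 3 * rel_info s P Q \<and>
        8 * R powr (2 - s) / (R + 1) ^ 3 * (rho_rel_info s P Q - rel_info s P Q) \<le> triang_discr_star P Q \<and>
        triang_discr_star P Q \<le> 8 * r powr (2 - s) / (r + 1) ^ 3 * (rho_rel_info s P Q - rel_info s P Q) \<and>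
        (r < R \<longrightarrow>
        8 * R powr (2 - s) / (R + 1) ^ 3 * (beta_rel_info s r R - rel_info s P Q) \<le> beta_triang r R - triang_discr P Q \<and>
        beta_triang r R - triang_discr P Q \<le> 8 * r powr (2 - s) / (r + 1) ^ 3 * (beta_rel_info s r R - rel_info s P Q)))"
proof -
  have bounds: "\<And>i. P $ i / Q $ i \<in> {r..R}"
    using assms by simp
  note main = triang_discr_rel_info_bounds[OF assms(2-6) bounds]
  show ?thesis
    unfolding curv_ratio_def[symmetric]
    \<comment> \<open>Unification takes \<open>m\<close> and \<open>M\<close> from the goal: the
      values at \<open>r\<close> and \<open>R\<close> for \<open>s \<le> -1\<close>, at
      \<open>R\<close> and \<open>r\<close> for \<open>s \<ge> 2\<close>.\<close>
    by (rule conjI; rule impI; rule main)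
      (use \<open>0 < r\<close> in \<open>auto intro: curv_ratio_mono curv_ratio_antimono\<close>)
qed

end
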